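(* For every integer $m\geq 0$ and every integer $k\ge 1$, $$\genfrac{[}{]}{0pt}{}{1/2+k}{k}_q \;\geq_q\; \genfrac{[}{]}{0pt}{}{m+1/2+k}{k}_q .$$
   Context: Let $\mathcal P=\bigcup_{b\ge 1}\mathbb{Q}[[q^{1/b}]]$ be the ring of Puiseux series over $\mathbb{Q}$ with nonnegative exponents (formal series in $q$ whose exponents are nonnegative rationals admitting a common denominator). For $A(q)=\sum_{\alpha\in\mathbb{Q}_{\ge 0}}a_\alpha q^\alpha\in\mathcal P$, the integer trace is $\operatorname{Tr}_{\mathbb Z}A(q):=\sum_{d\in\mathbb{Z}_{\ge 0}}a_d q^d\in\mathbb{Q}[[q]]$, i.e. all terms with nonintegral exponent are discarded. For $F,G\in\mathcal P$, write $F\geq_q G$ if and only if every coefficient of $\operatorname{Tr}_{\mathbb Z}(F-G)$ is nonnegative. For an integer $k\ge 0$ and a positive rational $r$, the generalized Gaussian binomial coefficient is the element of $\mathcal P$ $$\genfrac{[}{]}{0pt}{}{r+k}{k}_q=\frac{(1-q^{r+1})(1-q^{r+2})\cdots(1-q^{r+k})}{(1-q)(1-q^2)\cdots(1-q^k)};$$ here $\genfrac{[}{]}{0pt}{}{m+1/2+k}{k}_q$ is the case $r=m+\tfrac12$. *)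

theory Defs
  imports Complex_Main "HOL-Computational_Algebra.Formal_Power_Series"
begin

text \<open>
  A Puiseux series with nonnegative exponents is represented by its coefficient function, indexed by
  rational exponents. Membership in \<open>\<rat>[[q\<^sup>1\<^sup>/\<^sup>b]]\<close> means that every exponent in the support has the form
  \<open>n / b\<close> with \<open>n\<close> natural.
\<close>

definition puiseux_denom :: "nat \<Rightarrow> (rat \<Rightarrow> rat) \<Rightarrow> bool" where
  "puiseux_denom b f \<longleftrightarrow> b \<ge> 1 \<and> (\<forall>\<alpha>. f \<alpha> \<noteq> 0 \<longrightarrow> (\<exists>n::nat. \<alpha> = of_nat n / of_nat b))"

typedef puiseux = "{f :: rat \<Rightarrow> rat. \<exists>b. puiseux_denom b f}"
  morphisms puiseux_coeff Abs_puiseux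
  by (rule exI[of _ "\<lambda>_. 0"]) (auto simp: puiseux_denom_def)

setup_lifting type_definition_puiseux

lemma puiseux_denom_mult:
  assumes "puiseux_denom b f" "c \<ge> 1"
  shows "puiseux_denom (b * c) f"
  unfolding puiseux_denom_def
proof (intro conjI allI impI)
  show "b * c \<ge> 1" using assms by (auto simp: puiseux_denom_def)
  fix \<alpha> assume "f \<alpha> \<noteq> 0"
  then obtain n where "\<alpha> = of_nat n / of_nat b" using assms by (auto simp: puiseux_denom_def)
  then have "\<alpha> = of_nat (n * c) / of_nat (b * c)" using assms by simp
  then show "\<exists>n. \<alpha> = of_nat n / of_nat (b * c)" by blast
qed

lemma puiseux_denom_common:
  assumes "puiseux_denom b f" "puiseux_denom c g"
  shows "puiseux_denom (b * c) f" "puiseux_denom (b * c) g"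
  using puiseux_denom_mult[OF assms(1), of c] puiseux_denom_mult[OF assms(2), of b] assms
  by (auto simp: puiseux_denom_def mult.commute)

text \<open>The convolution below has finitely many nonzero terms; see \<open>puiseux_conv_denom\<close>.\<close>

definition puiseux_conv :: "(rat \<Rightarrow> rat) \<Rightarrow> (rat \<Rightarrow> rat) \<Rightarrow> rat \<Rightarrow> rat" where
  "puiseux_conv f g \<gamma> = (\<Sum>\<alpha> | f \<alpha> \<noteq> 0 \<and> g (\<gamma> - \<alpha>) \<noteq> 0. f \<alpha> * g (\<gamma> - \<alpha>))"

lemma puiseux_conv_nonzero:
  assumes "puiseux_conv f g \<gamma> \<noteq> 0"
  shows "\<exists>\<alpha>. f \<alpha> \<noteq> 0 \<and> g (\<gamma> - \<alpha>) \<noteq> 0"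
proof (rule ccontr)
  assume "\<not> ?thesis"
  then have "{\<alpha>. f \<alpha> \<noteq> 0 \<and> g (\<gamma> - \<alpha>) \<noteq> 0} = {}" by auto
  with assms show False unfolding puiseux_conv_def by simp
qed

lemma puiseux_denom_conv:
  assumes f: "puiseux_denom b f" and g: "puiseux_denom b g"
  shows "puiseux_denom b (puiseux_conv f g)"
  unfolding puiseux_denom_def
proof (intro conjI allI impI)
  show "b \<ge> 1" using f by (auto simp: puiseux_denom_def)
  fix \<gamma> assume "puiseux_conv f g \<gamma> \<noteq> 0"
  then obtain \<alpha> where "f \<alpha> \<noteq> 0" "g (\<gamma> - \<alpha>) \<noteq> 0" using puiseux_conv_nonzero by blast
  then obtain n m where "\<alpha> = of_nat n / of_nat b" "\<gamma> - \<alpha> = of_nat m / of_nat b"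
    using f g unfolding puiseux_denom_def by meson
  then have "\<gamma> = of_nat (n + m) / of_nat b" by (simp add: add_divide_distrib)
  then show "\<exists>n. \<gamma> = of_nat n / of_nat b" by blast
qed

lemma puiseux_conv_denom:
  assumes f: "puiseux_denom b f" and g: "puiseux_denom b g"
  shows "finite {\<alpha>. f \<alpha> \<noteq> 0 \<and> g (\<gamma> - \<alpha>) \<noteq> 0}"
    and "puiseux_conv f g (of_nat n / of_nat b) =
      (\<Sum>i=0..n. f (of_nat i / of_nat b) * g (of_nat (n - i) / of_nat b))"
proof -
  have b: "b > 0" using f by (simp add: puiseux_denom_def)
  have sub: "{\<alpha>. f \<alpha> \<noteq> 0 \<and> g (of_nat n / of_nat b - \<alpha>) \<noteq> 0}
      \<subseteq> (\<lambda>i. of_nat i / of_nat b) ` {0..n}" for n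
  proof
    fix \<alpha> assume "\<alpha> \<in> {\<alpha>. f \<alpha> \<noteq> 0 \<and> g (of_nat n / of_nat b - \<alpha>) \<noteq> 0}"
    then obtain i j where i: "\<alpha> = of_nat i / of_nat b"
      and j: "of_nat n / of_nat b - \<alpha> = of_nat j / of_nat b"
      using f g unfolding puiseux_denom_def by blast
    then have "(of_nat n :: rat) = of_nat (i + j)" using b by (simp add: field_simps)
    then have "n = i + j" by (simp only: of_nat_eq_iff)
    with i show "\<alpha> \<in> (\<lambda>i. of_nat i / of_nat b) ` {0..n}" by auto
  qed
  show "finite {\<alpha>. f \<alpha> \<noteq> 0 \<and> g (\<gamma> - \<alpha>) \<noteq> 0}"
  proof (cases "{\<alpha>. f \<alpha> \<noteq> 0 \<and> g (\<gamma> - \<alpha>) \<noteq> 0} = {}")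
    case False
    then obtain \<alpha> where "f \<alpha> \<noteq> 0" "g (\<gamma> - \<alpha>) \<noteq> 0" by blast
    then obtain i j where "\<alpha> = of_nat i / of_nat b" "\<gamma> - \<alpha> = of_nat j / of_nat b"
      using f g unfolding puiseux_denom_def by meson
    then have "\<gamma> = of_nat (i + j) / of_nat b" by (simp add: add_divide_distrib)
    then show ?thesis using finite_subset[OF sub[of "i + j"]] by simp
  qed (simp only: finite.emptyI)
  have inj: "inj_on (\<lambda>i. of_nat i / of_nat b :: rat) {0..n}"
    using b by (auto simp: inj_on_def)
  have "puiseux_conv f g (of_nat n / of_nat b) =
      (\<Sum>\<alpha>\<in>(\<lambda>i. of_nat i / of_nat b) ` {0..n}. f \<alpha> * g (of_nat n / of_nat b - \<alpha>))"
    unfolding puiseux_conv_def by (rule sum.mono_neutral_left[OF _ sub]) auto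
  also have "\<dots> = (\<Sum>i=0..n. f (of_nat i / of_nat b) * g (of_nat (n - i) / of_nat b))"
    unfolding sum.reindex[OF inj] by (intro sum.cong) (auto simp: of_nat_diff diff_divide_distrib)
  finally show "puiseux_conv f g (of_nat n / of_nat b) =
      (\<Sum>i=0..n. f (of_nat i / of_nat b) * g (of_nat (n - i) / of_nat b))" .
qed

instantiation puiseux :: "{zero, one, plus, minus, uminus, times}"
begin

lift_definition zero_puiseux :: puiseux is "\<lambda>_. 0"
  by (auto simp: puiseux_denom_def)

lift_definition one_puiseux :: puiseux is "\<lambda>\<alpha>. if \<alpha> = 0 then 1 else 0"
  by (rule exI[of _ 1]) (auto simp: puiseux_denom_def intro: exI[of _ 0])

lift_definition plus_puiseux :: "puiseux \<Rightarrow> puiseux \<Rightarrow> puiseux" is "\<lambda>f g \<alpha>. f \<alpha> + g \<alpha>"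
proof (elim exE)
  fix f g b c assume "puiseux_denom b f" "puiseux_denom c g"
  note * = puiseux_denom_common[OF this]
  show "\<exists>b. puiseux_denom b (\<lambda>\<alpha>. f \<alpha> + g \<alpha>)"
    by (rule exI[of _ "b * c"]) (use * in \<open>force simp: puiseux_denom_def\<close>)
qed

lift_definition minus_puiseux :: "puiseux \<Rightarrow> puiseux \<Rightarrow> puiseux" is "\<lambda>f g \<alpha>. f \<alpha> - g \<alpha>"
proof (elim exE)
  fix f g b c assume "puiseux_denom b f" "puiseux_denom c g"
  note * = puiseux_denom_common[OF this]
  show "\<exists>b. puiseux_denom b (\<lambda>\<alpha>. f \<alpha> - g \<alpha>)"
    by (rule exI[of _ "b * c"]) (use * in \<open>force simp: puiseux_denom_def\<close>)
qed

lift_definition uminus_puiseux :: "puiseux \<Rightarrow> puiseux" is "\<lambda>f \<alpha>. - f \<alpha>"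
  by (auto simp: puiseux_denom_def)

lift_definition times_puiseux :: "puiseux \<Rightarrow> puiseux \<Rightarrow> puiseux" is puiseux_conv
  using puiseux_denom_common puiseux_denom_conv by meson

instance ..

end

text \<open>The substitution \<open>X \<mapsto> q\<^sup>1\<^sup>/\<^sup>b\<close>; the junk value at \<open>b = 0\<close> is \<open>0\<close>.\<close>

lift_definition fps_to_puiseux :: "nat \<Rightarrow> rat fps \<Rightarrow> puiseux" is
  "\<lambda>b F \<alpha>. if b \<ge> 1 \<and> (\<exists>n::nat. \<alpha> = of_nat n / of_nat b)
     then fps_nth F (nat \<lfloor>\<alpha> * of_nat b\<rfloor>) else 0"
  subgoal for b F by (rule exI[of _ "max b 1"]) (auto simp: puiseux_denom_def max_def)
  done

lemma puiseux_coeff_fps_to_puiseux: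
  "b \<ge> 1 \<Longrightarrow> puiseux_coeff (fps_to_puiseux b F) (of_nat n / of_nat b) = fps_nth F n"
  by transfer auto

lemma puiseux_denom_fps_to_puiseux:
  "b \<ge> 1 \<Longrightarrow> puiseux_denom b (puiseux_coeff (fps_to_puiseux b F))"
  by transfer (auto simp: puiseux_denom_def)

lemma puiseux_eqI:
  assumes "puiseux_denom b (puiseux_coeff x)" "puiseux_denom b (puiseux_coeff y)"
    and "\<And>n. puiseux_coeff x (of_nat n / of_nat b) = puiseux_coeff y (of_nat n / of_nat b)"
  shows "x = y"
proof -
  have "puiseux_coeff x \<alpha> = puiseux_coeff y \<alpha>" for \<alpha>
    using assms unfolding puiseux_denom_def by metis
  then show ?thesis by (simp add: puiseux_coeff_inject[symmetric] fun_eq_iff)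
qed

lemma fps_to_puiseux_surj:
  assumes "puiseux_denom b (puiseux_coeff x)"
  obtains F where "x = fps_to_puiseux b F"
proof
  have b: "b \<ge> 1" using assms by (simp add: puiseux_denom_def)
  show "x = fps_to_puiseux b (Abs_fps (\<lambda>n. puiseux_coeff x (of_nat n / of_nat b)))"
    by (rule puiseux_eqI[OF assms puiseux_denom_fps_to_puiseux[OF b]])
       (simp add: puiseux_coeff_fps_to_puiseux[OF b])
qed

lemma puiseux_denom_ex: "\<exists>b. puiseux_denom b (puiseux_coeff x)"
  using puiseux_coeff[of x] by simp

lemma fps_to_puiseux_cases2:
  obtains b F G where "b \<ge> 1" "x = fps_to_puiseux b F" "y = fps_to_puiseux b G"
proof -
  obtain b c where "puiseux_denom b (puiseux_coeff x)" "puiseux_denom c (puiseux_coeff y)"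
    using puiseux_denom_ex by meson
  note d = puiseux_denom_common[OF this]
  from d(1) have "b * c \<ge> 1" by (simp add: puiseux_denom_def)
  then show ?thesis using that d fps_to_puiseux_surj by metis
qed

lemma fps_to_puiseux_cases3:
  obtains b F G H where "b \<ge> 1" "x = fps_to_puiseux b F" "y = fps_to_puiseux b G"
    "z = fps_to_puiseux b H"
proof -
  obtain b c d where b: "puiseux_denom b (puiseux_coeff x)"
    and c: "puiseux_denom c (puiseux_coeff y)" and d: "puiseux_denom d (puiseux_coeff z)"
    using puiseux_denom_ex by meson
  have cd: "c * d \<ge> 1" "d \<ge> 1" "b \<ge> 1" using b c d by (auto simp: puiseux_denom_def)
  have "puiseux_denom (b * (c * d)) (puiseux_coeff x)"
    "puiseux_denom (b * (c * d)) (puiseux_coeff y)"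
    "puiseux_denom (b * (c * d)) (puiseux_coeff z)"
    using puiseux_denom_mult[OF b cd(1)] puiseux_denom_mult[OF puiseux_denom_common(1)[OF c d] cd(3)]
      puiseux_denom_mult[OF puiseux_denom_common(2)[OF c d] cd(3)] by (simp_all add: mult_ac)
  moreover from this have "b * (c * d) \<ge> 1" by (simp add: puiseux_denom_def)
  ultimately show ?thesis using that fps_to_puiseux_surj by metis
qed

lemma puiseux_coeff_simps [simp]:
  "puiseux_coeff 0 \<alpha> = 0"
  "puiseux_coeff 1 \<alpha> = (if \<alpha> = 0 then 1 else 0)"
  "puiseux_coeff (x + y) \<alpha> = puiseux_coeff x \<alpha> + puiseux_coeff y \<alpha>"
  "puiseux_coeff (x - y) \<alpha> = puiseux_coeff x \<alpha> - puiseux_coeff y \<alpha>"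
  "puiseux_coeff (- x) \<alpha> = - puiseux_coeff x \<alpha>"
  by (transfer; simp)+

lemma fps_to_puiseux_mult:
  assumes b: "b \<ge> 1"
  shows "fps_to_puiseux b (F * G) = fps_to_puiseux b F * fps_to_puiseux b G"
proof (rule puiseux_eqI)
  note d = puiseux_denom_fps_to_puiseux[OF b]
  show "puiseux_denom b (puiseux_coeff (fps_to_puiseux b (F * G)))" by (rule d)
  show "puiseux_denom b (puiseux_coeff (fps_to_puiseux b F * fps_to_puiseux b G))"
    unfolding times_puiseux.rep_eq by (rule puiseux_denom_conv[OF d d])
  show "puiseux_coeff (fps_to_puiseux b (F * G)) (of_nat n / of_nat b) =
      puiseux_coeff (fps_to_puiseux b F * fps_to_puiseux b G) (of_nat n / of_nat b)" for n
    unfolding times_puiseux.rep_eq puiseux_conv_denom(2)[OF d d] puiseux_coeff_fps_to_puiseux[OF b]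
    by (rule fps_mult_nth)
qed

lemma fps_to_puiseux_eq_iff:
  assumes "b \<ge> 1"
  shows "fps_to_puiseux b F = fps_to_puiseux b G \<longleftrightarrow> F = G"
  using puiseux_coeff_fps_to_puiseux[OF assms] by (metis fps_ext)

lemma fps_to_puiseux_0: "fps_to_puiseux b 0 = 0"
  by transfer auto

lemma fps_to_puiseux_1: "b \<ge> 1 \<Longrightarrow> fps_to_puiseux b 1 = 1"
  by transfer (auto simp: fun_eq_iff intro: exI[of _ 0])

lemma fps_to_puiseux_add:
  "fps_to_puiseux b (F + G) = fps_to_puiseux b F + fps_to_puiseux b G"
  by transfer (rule ext, simp only: fps_add_nth fps_sub_nth split: if_split, blast intro: add_0_right[symmetric] diff_0_right[symmetric])

lemma fps_to_puiseux_diff: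
  "fps_to_puiseux b (F - G) = fps_to_puiseux b F - fps_to_puiseux b G"
  by transfer (rule ext, simp only: fps_add_nth fps_sub_nth split: if_split, blast intro: add_0_right[symmetric] diff_0_right[symmetric])

instance puiseux :: comm_ring_1
proof
  fix x y z :: puiseux
  show "x + y + z = x + (y + z)" "x + y = y + x" "0 + x = x" "- x + x = 0" "x - y = x + - y"
    by (transfer; simp add: algebra_simps)+
  show "(0::puiseux) \<noteq> 1"
    by transfer (auto simp: fun_eq_iff)
  show "x * y = y * x"
    by (rule fps_to_puiseux_cases2[of x y]) (simp add: fps_to_puiseux_mult[symmetric] mult.commute)
  show "x * y * z = x * (y * z)"
    by (rule fps_to_puiseux_cases3[of x y z]) (simp add: fps_to_puiseux_mult[symmetric] mult.assoc)
  show "(x + y) * z = x * z + y * z"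
    by (rule fps_to_puiseux_cases3[of x y z])
       (simp add: fps_to_puiseux_mult[symmetric] fps_to_puiseux_add[symmetric] distrib_right)
  show "1 * x = x"
    by (rule fps_to_puiseux_cases2[of x x])
       (simp add: fps_to_puiseux_mult[symmetric] flip: fps_to_puiseux_1)
qed

instance puiseux :: idom
proof
  fix x y :: puiseux
  show "x \<noteq> 0 \<Longrightarrow> y \<noteq> 0 \<Longrightarrow> x * y \<noteq> 0"
    by (rule fps_to_puiseux_cases2[of x y])
       (metis fps_to_puiseux_0 fps_to_puiseux_eq_iff fps_to_puiseux_mult mult_eq_0_iff)
qed

text \<open>
  Exact division: \<open>x div y\<close> is the quotient of \<open>x\<close> by \<open>y\<close> if \<open>y \<noteq> 0\<close> divides \<open>x\<close>, which is unique since
  the ring is a domain. It is only used where this is the case; see \<open>gauss_binom_exact\<close>.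
\<close>

instantiation puiseux :: idom_divide
begin

definition divide_puiseux :: "puiseux \<Rightarrow> puiseux \<Rightarrow> puiseux" where
  "divide_puiseux x y = (if y dvd x \<and> y \<noteq> 0 then THE z. z * y = x else 0)"

instance
proof
  show "y \<noteq> 0 \<Longrightarrow> x * y div y = x" for x y :: puiseux
    by (auto simp: divide_puiseux_def)
  show "x div 0 = 0" for x :: puiseux
    by (simp add: divide_puiseux_def)
qed

end

text \<open>The monomial \<open>q\<^sup>\<alpha>\<close>; the junk value at \<open>\<alpha> < 0\<close> is \<open>0\<close>.\<close>

lift_definition q_pow :: "rat \<Rightarrow> puiseux" is
  "\<lambda>\<alpha> \<beta>. if \<alpha> \<ge> 0 \<and> \<beta> = \<alpha> then 1 else 0"
proof -
  fix \<alpha> :: rat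
  show "\<exists>b. puiseux_denom b (\<lambda>\<beta>. if \<alpha> \<ge> 0 \<and> \<beta> = \<alpha> then 1 else 0)"
  proof (cases "\<alpha> \<ge> 0")
    case True
    obtain n d :: int where nd: "d > 0" "\<alpha> = of_int n / of_int d"
      by (metis Fract_of_int_quotient Rat_cases)
    with True have "n \<ge> 0" by (simp add: zero_le_divide_iff)
    with nd have "\<alpha> = of_nat (nat n) / of_nat (nat d)" by simp
    with nd(1) have "puiseux_denom (nat d) (\<lambda>\<beta>. if \<alpha> \<ge> 0 \<and> \<beta> = \<alpha> then 1 else 0)"
      unfolding puiseux_denom_def by auto
    then show ?thesis by blast
  qed (auto simp: puiseux_denom_def)
qed

definition integer_trace :: "puiseux \<Rightarrow> rat fps" where
  "integer_trace A = Abs_fps (\<lambda>d. puiseux_coeff A (of_nat d))"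

definition q_geq :: "puiseux \<Rightarrow> puiseux \<Rightarrow> bool" (infix "\<ge>\<^sub>q" 50) where
  "F \<ge>\<^sub>q G \<longleftrightarrow> (\<forall>d. fps_nth (integer_trace (F - G)) d \<ge> 0)"

text \<open>
  The first argument is the upper entry \<open>a = r + k\<close> of the binomial coefficient, so that
  \<open>q_pow (a - k + i)\<close> is \<open>q\<close> to the power \<open>r + i\<close>. It is meant for \<open>a > k\<close>, i.e. \<open>r > 0\<close>.
\<close>

definition gauss_binom :: "rat \<Rightarrow> nat \<Rightarrow> puiseux" where
  "gauss_binom a k =
     (\<Prod>i=1..k. 1 - q_pow (a - of_nat k + of_nat i)) div (\<Prod>i=1..k. 1 - q_pow (of_nat i))"

lemma q_pow_of_nat: "q_pow (of_nat i) = fps_to_puiseux 1 (fps_X ^ i)"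
  by transfer (auto simp: fun_eq_iff)

lemma gauss_binom_denom_unit: "(\<Prod>i=1..k. 1 - q_pow (of_nat i)) dvd 1"
proof (induction k)
  case (Suc k)
  let ?F = "1 - fps_X ^ Suc k :: rat fps"
  have "?F * inverse ?F = 1"
    by (metis inverse_mult_eq_1' fps_X_power_nth fps_one_nth fps_sub_nth diff_zero nat.distinct(1)
        zero_neq_one)
  then have "fps_to_puiseux 1 ?F * fps_to_puiseux 1 (inverse ?F) = 1"
    by (simp only: fps_to_puiseux_mult[symmetric] fps_to_puiseux_1 order_refl)
  then have "1 - q_pow (of_nat (Suc k)) dvd 1"
    unfolding q_pow_of_nat fps_to_puiseux_diff by (simp add: fps_to_puiseux_1) (metis dvdI)
  with Suc show ?case
    using mult_dvd_mono[of "\<Prod>i=1..k. 1 - q_pow (of_nat i)" 1 "1 - q_pow (of_nat (Suc k))" 1]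
    by (simp del: of_nat_Suc)
qed simp

lemma gauss_binom_exact:
  "gauss_binom a k * (\<Prod>i=1..k. 1 - q_pow (of_nat i)) =
     (\<Prod>i=1..k. 1 - q_pow (a - of_nat k + of_nat i))"
proof -
  let ?D = "\<Prod>i=1..k. 1 - q_pow (of_nat i)"
  let ?N = "\<Prod>i=1..k. 1 - q_pow (a - of_nat k + of_nat i)"
  have "?D dvd ?N"
    by (rule dvd_trans[OF gauss_binom_denom_unit one_dvd])
  then obtain c where "?N = ?D * c" by (rule dvdE)
  then have N: "?N = c * ?D" by (simp only: mult.commute)
  have "?D \<noteq> 0"
  proof
    assume "?D = 0"
    with gauss_binom_denom_unit[of k] show False by (simp only: dvd_0_left_iff) simp
  qed
  then show ?thesis
    unfolding gauss_binom_def N by (subst nonzero_mult_div_cancel_right) simp_all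
qed

end

theory Submission
  imports Defs
begin

text \<open>
  Write \<open>E n\<close> for \<open>1 / ((1 - q) (1 - q\<^sup>2) \<cdots> (1 - q\<^sup>n))\<close>. The \<open>q\<close>-binomial theorem
  (\<open>q_binomial_theorem\<close>), divided by the denominator of the Gaussian binomial coefficient, expands
  that coefficient as the sum over \<open>j \<le> k\<close> of \<open>(-1)\<^sup>j q\<^bsup>j r + j (j + 1) / 2\<^esup> E j E (k - j)\<close>. For
  \<open>r = m + 1/2\<close> the exponent \<open>j r\<close> is an integer exactly when \<open>j\<close> is even, so the integer trace
  deletes all the negative terms (\<open>integer_trace_gauss_binom\<close>).

  Comparing the traces for \<open>0\<close> and \<open>m\<close> term by term, the \<open>j\<close>-th difference is a product of series
  with nonnegative coefficients and \<open>(1 - q\<^bsup>j m\<^esup>) E j\<close>. The latter also has nonnegative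
  coefficients: the factor \<open>1 - q\<^sup>j\<close> of \<open>1 - q\<^bsup>j m\<^esup>\<close> cancels against the denominator of \<open>E j\<close>, and
  the cofactor is a geometric sum (\<open>fps_nonneg_one_minus_mult_inv_qfact\<close>).
\<close>

section \<open>The \<open>q\<close>-binomial theorem\<close>

text \<open>
  The induction rests on splitting \<open>1 - x\<^sup>k = (1 - x\<^bsup>k - j\<^esup>) + x\<^bsup>k - j\<^esup> (1 - x\<^sup>j)\<close> in the \<open>j\<close>-th term:
  the first part lowers \<open>e (k - j)\<close>, the second lowers \<open>e j\<close>, and both give the sum for
  \<open>k - 1\<close>, the second one after an index shift and with an extra factor \<open>- y x\<^sup>k\<close>. The sequence \<open>e\<close>
  stands for the reciprocals of the products of \<open>1 - x\<^sup>i\<close>; stating their recurrence instead keeps the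
  identity free of division. The exponent \<open>\<Sum>{..j}\<close> is \<open>j (j + 1) / 2\<close>.
\<close>

lemma q_binomial_theorem:
  fixes x y :: "'a :: comm_ring_1" and e :: "nat \<Rightarrow> 'a"
  assumes e0: "e 0 = 1" and eSuc: "\<And>n. (1 - x ^ Suc n) * e (Suc n) = e n"
  shows "(\<Sum>j\<le>k. (- y) ^ j * x ^ \<Sum>{..j} * e j * e (k - j)) * (\<Prod>i=1..k. 1 - x ^ i) =
    (\<Prod>i=1..k. 1 - y * x ^ i)"
proof (induction k)
  case 0
  show ?case by (simp add: e0)
next
  case (Suc k)
  define a where "a j = (- y) ^ j * x ^ \<Sum>{..j}" for j :: nat
  define S where "S k = (\<Sum>j\<le>k. a j * e j * e (k - j))" for k
  have split: "1 - x ^ Suc k = (1 - x ^ (Suc k - j)) + x ^ (Suc k - j) * (1 - x ^ j)"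
    if "j \<le> Suc k" for j
  proof -
    have "x ^ (Suc k - j) * x ^ j = x ^ Suc k"
      using that by (simp only: power_add[symmetric] le_add_diff_inverse2)
    then show ?thesis by (simp add: algebra_simps)
  qed
  have shift: "a (Suc j) * x ^ (k - j) = - y * x ^ Suc k * a j" if "j \<le> k" for j
  proof -
    have "a (Suc j) * x ^ (k - j) = - y * (x ^ Suc j * x ^ (k - j)) * a j"
      by (simp add: a_def power_add mult_ac)
    also have "x ^ Suc j * x ^ (k - j) = x ^ Suc k"
      using that by (simp only: power_add[symmetric]) simp
    finally show ?thesis .
  qed
  have "(1 - x ^ Suc k) * S (Suc k) =
      (\<Sum>j\<le>Suc k. a j * e j * ((1 - x ^ (Suc k - j)) * e (Suc k - j)))
      + (\<Sum>j\<le>Suc k. a j * x ^ (Suc k - j) * ((1 - x ^ j) * e j) * e (Suc k - j))"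
    unfolding S_def sum_distrib_left sum.distrib[symmetric]
  proof (rule sum.cong[OF refl])
    fix j assume "j \<in> {..Suc k}"
    then have "j \<le> Suc k" by simp
    show "(1 - x ^ Suc k) * (a j * e j * e (Suc k - j)) =
        a j * e j * ((1 - x ^ (Suc k - j)) * e (Suc k - j))
        + a j * x ^ (Suc k - j) * ((1 - x ^ j) * e j) * e (Suc k - j)"
      unfolding split[OF \<open>j \<le> Suc k\<close>] by (simp add: algebra_simps)
  qed
  also have "(\<Sum>j\<le>Suc k. a j * e j * ((1 - x ^ (Suc k - j)) * e (Suc k - j))) = S k"
  proof -
    have "(\<Sum>j\<le>Suc k. a j * e j * ((1 - x ^ (Suc k - j)) * e (Suc k - j))) =
        (\<Sum>j\<le>k. a j * e j * ((1 - x ^ (Suc k - j)) * e (Suc k - j)))"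
      by simp
    also have "\<dots> = S k"
      unfolding S_def by (intro sum.cong) (simp_all only: atMost_iff Suc_diff_le eSuc)
    finally show ?thesis .
  qed
  also have "(\<Sum>j\<le>Suc k. a j * x ^ (Suc k - j) * ((1 - x ^ j) * e j) * e (Suc k - j)) =
      - y * x ^ Suc k * S k"
  proof -
    have "(\<Sum>j\<le>Suc k. a j * x ^ (Suc k - j) * ((1 - x ^ j) * e j) * e (Suc k - j)) =
        (\<Sum>j\<le>k. a (Suc j) * x ^ (k - j) * ((1 - x ^ Suc j) * e (Suc j)) * e (k - j))"
      unfolding sum.atMost_Suc_shift by simp
    also have "\<dots> = (\<Sum>j\<le>k. - y * x ^ Suc k * (a j * e j * e (k - j)))"
    proof (intro sum.cong refl)
      fix j assume "j \<in> {..k}"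
      then have "j \<le> k" by simp
      show "a (Suc j) * x ^ (k - j) * ((1 - x ^ Suc j) * e (Suc j)) * e (k - j) =
          - y * x ^ Suc k * (a j * e j * e (k - j))"
        unfolding eSuc shift[OF \<open>j \<le> k\<close>] by (simp only: mult.assoc)
    qed
    finally show ?thesis by (simp only: S_def sum_distrib_left)
  qed
  finally have step: "(1 - x ^ Suc k) * S (Suc k) = (1 - y * x ^ Suc k) * S k"
    by (simp add: algebra_simps)
  have IH: "S k * (\<Prod>i=1..k. 1 - x ^ i) = (\<Prod>i=1..k. 1 - y * x ^ i)"
    using Suc unfolding S_def a_def .
  have "S (Suc k) * (\<Prod>i=1..Suc k. 1 - x ^ i) =
      ((1 - x ^ Suc k) * S (Suc k)) * (\<Prod>i=1..k. 1 - x ^ i)"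
    by (simp add: mult_ac)
  also have "\<dots> = (1 - y * x ^ Suc k) * (\<Prod>i=1..k. 1 - y * x ^ i)"
    unfolding step mult.assoc IH ..
  finally show ?case by (simp add: S_def a_def mult_ac)
qed

section \<open>Power series with nonnegative coefficients\<close>

definition fps_nonneg :: "'a :: linordered_field fps \<Rightarrow> bool" where
  "fps_nonneg F \<longleftrightarrow> (\<forall>n. fps_nth F n \<ge> 0)"

lemma fps_nonneg_0: "fps_nonneg 0"
  by (simp add: fps_nonneg_def)

lemma fps_nonneg_1: "fps_nonneg 1"
  by (simp add: fps_nonneg_def)

lemma fps_nonneg_X_power: "fps_nonneg (fps_X ^ n)"
  by (simp add: fps_nonneg_def fps_X_power_iff)

lemma fps_nonneg_mult: "fps_nonneg F \<Longrightarrow> fps_nonneg G \<Longrightarrow> fps_nonneg (F * G)"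
  by (simp add: fps_nonneg_def fps_mult_nth sum_nonneg)

lemma fps_nonneg_sum: "(\<And>i. i \<in> A \<Longrightarrow> fps_nonneg (f i)) \<Longrightarrow> fps_nonneg (\<Sum>i\<in>A. f i)"
  by (simp add: fps_nonneg_def fps_sum_nth sum_nonneg)

lemma fps_one_minus_X_power_mult_inverse:
  "(1 - fps_X ^ Suc n) * inverse (1 - fps_X ^ Suc n :: 'a :: field fps) = 1"
  by (rule inverse_mult_eq_1') (simp del: power_Suc)

text \<open>
  The reciprocal \<open>G\<close> of \<open>1 - X\<^bsup>n + 1\<^esup>\<close> satisfies \<open>G = 1 + X\<^bsup>n + 1\<^esup> G\<close>, so each coefficient is \<open>0\<close>,
  \<open>1\<close> or an earlier coefficient.
\<close>

lemma fps_nonneg_inverse_one_minus_X_power: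
  "fps_nonneg (inverse (1 - fps_X ^ Suc n) :: 'a :: linordered_field fps)"
proof -
  define G :: "'a fps" where "G = inverse (1 - fps_X ^ Suc n)"
  have "(1 - fps_X ^ Suc n) * G = 1"
    unfolding G_def by (rule fps_one_minus_X_power_mult_inverse)
  then have G: "G = 1 + fps_X ^ Suc n * G"
    by (simp add: algebra_simps)
  have "fps_nth G d \<ge> 0" for d
  proof (induction d rule: less_induct)
    case (less d)
    have "fps_nth G d = fps_nth (1 + fps_X ^ Suc n * G) d"
      using G by simp
    also have "\<dots> = (if d = 0 then 1 else 0) + (if d < Suc n then 0 else fps_nth G (d - Suc n))"
      unfolding fps_add_nth fps_X_power_mult_nth fps_one_nth ..
    also have "\<dots> \<ge> 0"
      using less[of "d - Suc n"] by auto
    finally show ?case .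
  qed
  then show ?thesis by (simp add: fps_nonneg_def G_def)
qed

definition inv_qfact :: "nat \<Rightarrow> 'a :: field fps" where
  "inv_qfact n = (\<Prod>i=1..n. inverse (1 - fps_X ^ i))"

lemma inv_qfact_0: "inv_qfact 0 = 1"
  by (simp add: inv_qfact_def)

lemma inv_qfact_Suc: "(1 - fps_X ^ Suc n) * inv_qfact (Suc n) = inv_qfact n"
proof -
  have "(1 - fps_X ^ Suc n) * inv_qfact (Suc n) =
      inv_qfact n * ((1 - fps_X ^ Suc n) * inverse (1 - fps_X ^ Suc n))"
    unfolding inv_qfact_def by (simp add: mult_ac)
  then show ?thesis
    unfolding fps_one_minus_X_power_mult_inverse by simp
qed

lemma fps_nonneg_inv_qfact: "fps_nonneg (inv_qfact n)"
proof (induction n)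
  case (Suc n)
  then show ?case
    using fps_nonneg_mult[OF Suc fps_nonneg_inverse_one_minus_X_power[of n]]
    by (simp add: inv_qfact_def mult_ac)
qed (simp add: inv_qfact_0 fps_nonneg_1)

text \<open>
  The only step where a minus sign has to be absorbed: \<open>1 - X\<^bsup>j m\<^esup>\<close> is \<open>1 - X\<^sup>j\<close> times a geometric sum,
  and \<open>1 - X\<^sup>j\<close> cancels the last factor of the denominator. For \<open>j = 0\<close> there is no such factor, but then
  the whole product is \<open>0\<close>.
\<close>

lemma fps_nonneg_one_minus_mult_inv_qfact:
  "fps_nonneg ((1 - fps_X ^ (j * m)) * inv_qfact j :: 'a :: linordered_field fps)"
proof (cases j)
  case 0
  then show ?thesis by (simp add: fps_nonneg_0)
next
  case (Suc n)
  have "(1 - fps_X ^ (j * m)) * inv_qfact j =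
      (\<Sum>i<m. fps_X ^ (j * i)) * ((1 - fps_X ^ Suc n) * inv_qfact (Suc n) :: 'a fps)"
    unfolding Suc power_mult one_diff_power_eq by (simp add: mult_ac)
  then show ?thesis
    unfolding inv_qfact_Suc
    by (simp add: fps_nonneg_mult fps_nonneg_sum fps_nonneg_X_power fps_nonneg_inv_qfact)
qed

section \<open>The integer trace of a half-integral Gaussian binomial coefficient\<close>

lemma q_pow_add:
  assumes "\<alpha> \<ge> 0" "\<beta> \<ge> 0"
  shows "q_pow (\<alpha> + \<beta>) = q_pow \<alpha> * q_pow \<beta>"
proof -
  have "puiseux_coeff (q_pow \<alpha> * q_pow \<beta>) \<gamma> = puiseux_coeff (q_pow (\<alpha> + \<beta>)) \<gamma>" for \<gamma>
  proof -
    have "{\<delta>. puiseux_coeff (q_pow \<alpha>) \<delta> \<noteq> 0 \<and> puiseux_coeff (q_pow \<beta>) (\<gamma> - \<delta>) \<noteq> 0} =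
        (if \<gamma> = \<alpha> + \<beta> then {\<alpha>} else {})"
      using assms by (auto simp: q_pow.rep_eq)
    then show ?thesis
      using assms by (simp add: times_puiseux.rep_eq puiseux_conv_def q_pow.rep_eq)
  qed
  then show ?thesis by (simp add: puiseux_coeff_inject[symmetric] fun_eq_iff)
qed

lemma q_pow_0: "q_pow 0 = 1"
  using q_pow_of_nat[of 0] by (simp add: fps_to_puiseux_1)

lemma q_pow_power: "\<alpha> \<ge> 0 \<Longrightarrow> q_pow \<alpha> ^ n = q_pow (of_nat n * \<alpha>)"
  by (induction n) (simp_all add: q_pow_0 distrib_right q_pow_add)

lemma integer_trace_diff: "integer_trace (A - B) = integer_trace A - integer_trace B"
  by (simp add: integer_trace_def fps_eq_iff)

lemma integer_trace_minus: "integer_trace (- A) = - integer_trace A"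
  by (simp add: integer_trace_def fps_eq_iff)

lemma integer_trace_sum: "integer_trace (\<Sum>i\<in>I. f i) = (\<Sum>i\<in>I. integer_trace (f i))"
  by (induction I rule: infinite_finite_induct) (simp_all add: integer_trace_def fps_eq_iff)

lemma integer_trace_fps_to_puiseux_1: "integer_trace (fps_to_puiseux 1 F) = F"
  using puiseux_coeff_fps_to_puiseux[of 1 F] by (simp add: integer_trace_def fps_eq_iff)

lemma integer_trace_q_pow_mult_nonint:
  assumes "\<alpha> \<notin> \<int>"
  shows "integer_trace (q_pow \<alpha> * fps_to_puiseux 1 F) = 0"
proof -
  have "puiseux_coeff (q_pow \<alpha> * fps_to_puiseux 1 F) (of_nat d) = 0" for d
  proof (rule ccontr)
    assume "\<not> ?thesis"
    then obtain \<beta> where "puiseux_coeff (q_pow \<alpha>) \<beta> \<noteq> 0"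
      and nz: "puiseux_coeff (fps_to_puiseux 1 F) (of_nat d - \<beta>) \<noteq> 0"
      unfolding times_puiseux.rep_eq using puiseux_conv_nonzero by blast
    then have "\<beta> = \<alpha>" by (auto simp: q_pow.rep_eq split: if_splits)
    moreover obtain n where "of_nat d - \<beta> = of_nat n / of_nat 1"
      using puiseux_denom_fps_to_puiseux[of 1 F] nz unfolding puiseux_denom_def by blast
    ultimately have "\<alpha> = of_nat d - of_nat n" by (simp add: algebra_simps)
    with assms show False by simp
  qed
  then show ?thesis by (simp add: integer_trace_def fps_eq_iff)
qed

lemma gauss_binom_expansion:
  assumes "r \<ge> 0"
  shows "gauss_binom (r + of_nat k) k =
    (\<Sum>j\<le>k. (- 1) ^ j * (q_pow (of_nat j * r) *
       fps_to_puiseux 1 (fps_X ^ \<Sum>{..j} * inv_qfact j * inv_qfact (k - j))))"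
proof -
  define e where "e n = fps_to_puiseux 1 (inv_qfact n)" for n
  have q: "q_pow 1 ^ n = q_pow (of_nat n)" for n
    by (simp add: q_pow_power)
  have e0: "e 0 = 1"
    by (simp add: e_def inv_qfact_0 fps_to_puiseux_1)
  have eSuc: "(1 - q_pow 1 ^ Suc n) * e (Suc n) = e n" for n
  proof -
    have "1 - q_pow 1 ^ Suc n = fps_to_puiseux 1 (1 - fps_X ^ Suc n)"
      unfolding q q_pow_of_nat fps_to_puiseux_diff by (simp add: fps_to_puiseux_1)
    then show ?thesis
      unfolding e_def by (simp only: fps_to_puiseux_mult[symmetric] inv_qfact_Suc order_refl)
  qed
  let ?S = "\<Sum>j\<le>k. (- q_pow r) ^ j * q_pow 1 ^ \<Sum>{..j} * e j * e (k - j)"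
  let ?D = "\<Prod>i=1..k. 1 - q_pow (of_nat i)"
  have "?S * ?D = (\<Prod>i=1..k. 1 - q_pow r * q_pow (of_nat i))"
    using q_binomial_theorem[of e "q_pow 1" "q_pow r" k, OF e0 eSuc] unfolding q .
  also have "\<dots> = (\<Prod>i=1..k. 1 - q_pow (r + of_nat k - of_nat k + of_nat i))"
    using assms by (simp add: q_pow_add)
  also have "\<dots> = gauss_binom (r + of_nat k) k * ?D"
    by (rule gauss_binom_exact[symmetric])
  finally have "?S * ?D = gauss_binom (r + of_nat k) k * ?D" .
  moreover have "?D \<noteq> 0"
    using gauss_binom_denom_unit[of k] by (metis dvd_0_left_iff zero_neq_one)
  ultimately have "gauss_binom (r + of_nat k) k = ?S" by simp
  also have "\<dots> = (\<Sum>j\<le>k. (- 1) ^ j * (q_pow (of_nat j * r) *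
       fps_to_puiseux 1 (fps_X ^ \<Sum>{..j} * inv_qfact j * inv_qfact (k - j))))"
  proof (rule sum.cong[OF refl])
    fix j
    have "(- q_pow r) ^ j = (- 1) ^ j * q_pow (of_nat j * r)"
      using assms by (simp add: power_minus[of "q_pow r"] q_pow_power)
    then show "(- q_pow r) ^ j * q_pow 1 ^ \<Sum>{..j} * e j * e (k - j) =
        (- 1) ^ j * (q_pow (of_nat j * r) *
          fps_to_puiseux 1 (fps_X ^ \<Sum>{..j} * inv_qfact j * inv_qfact (k - j)))"
      by (simp only: q q_pow_of_nat e_def fps_to_puiseux_mult order_refl mult.assoc)
  qed
  finally show ?thesis .
qed

text \<open>
  The surviving terms have even \<open>j\<close> and hence sign \<open>+1\<close>. The part \<open>X\<^bsup>j m\<^esup>\<close> of the monomial, which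
  alone depends on \<open>m\<close>, is kept apart for the comparison of different \<open>m\<close>.
\<close>

lemma integer_trace_gauss_binom:
  "integer_trace (gauss_binom (of_nat m + 1/2 + of_nat k) k) =
    (\<Sum>j\<le>k. if even j
       then fps_X ^ (j * m) * (fps_X ^ (j div 2 + \<Sum>{..j}) * inv_qfact j * inv_qfact (k - j))
       else 0)"
proof -
  let ?F = "\<lambda>j. fps_X ^ \<Sum>{..j} * inv_qfact j * inv_qfact (k - j) :: rat fps"
  have "integer_trace ((- 1) ^ j * (q_pow (of_nat j * (of_nat m + 1/2)) *
        fps_to_puiseux 1 (?F j))) =
      (if even j
       then fps_X ^ (j * m) * (fps_X ^ (j div 2 + \<Sum>{..j}) * inv_qfact j * inv_qfact (k - j))
       else 0)" for j
  proof (cases "even j")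
    case True
    then have "of_nat j * (of_nat m + 1/2 :: rat) = of_nat (j * m + j div 2)"
      by (auto elim!: evenE simp: algebra_simps)
    then have "q_pow (of_nat j * (of_nat m + 1/2)) = fps_to_puiseux 1 (fps_X ^ (j * m + j div 2))"
      by (simp only: q_pow_of_nat)
    then have "integer_trace ((- 1) ^ j * (q_pow (of_nat j * (of_nat m + 1/2)) *
        fps_to_puiseux 1 (?F j))) = fps_X ^ (j * m + j div 2) * ?F j"
      using True by (simp only: uminus_power_if if_True power_one mult_1
          fps_to_puiseux_mult[symmetric] order_refl integer_trace_fps_to_puiseux_1)
    also have "\<dots> = fps_X ^ (j * m) *
        (fps_X ^ (j div 2 + \<Sum>{..j}) * inv_qfact j * inv_qfact (k - j))"
      by (simp add: power_add mult_ac)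
    finally show ?thesis using True by simp
  next
    case False
    have "of_nat j * (of_nat m + 1/2 :: rat) \<notin> \<int>"
    proof
      assume "of_nat j * (of_nat m + 1/2 :: rat) \<in> \<int>"
      then obtain z where "of_nat j * (of_nat m + 1/2 :: rat) = of_int z"
        by (rule Ints_cases)
      then have "(of_int (int j * (2 * int m + 1)) :: rat) = of_int (2 * z)"
        by (simp add: field_simps)
      then have "int j * (2 * int m + 1) = 2 * z"
        by (simp only: of_int_eq_iff)
      then have "even (int j * (2 * int m + 1))" by simp
      with False show False by simp
    qed
    from integer_trace_q_pow_mult_nonint[OF this] False show ?thesis
      by (simp add: integer_trace_minus)
  qed
  then show ?thesis
    by (subst gauss_binom_expansion) (simp_all add: integer_trace_sum)
qed

theorem proposition5p1:
  fixes m k :: nat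
  assumes "k \<ge> 1"
  shows "gauss_binom (1/2 + of_nat k) k \<ge>\<^sub>q gauss_binom (of_nat m + 1/2 + of_nat k) k"
proof -
  let ?F = "\<lambda>j. fps_X ^ (j div 2 + \<Sum>{..j}) * inv_qfact (k - j) :: rat fps"
  have "integer_trace (gauss_binom (1/2 + of_nat k) k
        - gauss_binom (of_nat m + 1/2 + of_nat k) k) =
      (\<Sum>j\<le>k. if even j then ?F j * ((1 - fps_X ^ (j * m)) * inv_qfact j) else 0)"
    using integer_trace_gauss_binom[of 0 k]
    unfolding integer_trace_diff integer_trace_gauss_binom[of m k]
    by (auto simp: sum_subtractf[symmetric] algebra_simps intro!: sum.cong)
  moreover have "fps_nonneg \<dots>"
    by (intro fps_nonneg_sum)
      (simp add: fps_nonneg_mult fps_nonneg_X_power fps_nonneg_inv_qfact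
        fps_nonneg_one_minus_mult_inv_qfact fps_nonneg_0)
  ultimately show ?thesis
    by (simp add: q_geq_def fps_nonneg_def)
qed

end
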